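(* Let $n$ be an odd positive integer, let $d$ be a positive integer with $\gcd(d,n)=1$, and let $q=2^n$. Then the set $$\mathcal{O}_d=\{(y^{2^d}+y,\,y): y\in\mathbb{F}_q\}\cup\{(0),(1)\}$$ is a hyperoval in $\Pi(\mathbb{K}_n^{td})$.
   Context: $\mathrm{Tr}:\mathbb{F}_q\to\mathbb{F}_2$ is the absolute trace. $\mathbb{K}_n^{td}=(\mathbb{F}_q,+,\circ)$ ($n$ odd) is the presemifield with $x\circ y=xy+\mathrm{Tr}(x)\,y^{2^{n-1}}+\mathrm{Tr}(x^2y)$. The plane $\Pi(\mathbb{K}_n^{td})$ has affine points $(a,b)$, $a,b\in\mathbb{F}_q$, points at infinity $(a)$, $a\in\mathbb{F}_q\cup\{\infty\}$, and lines: the line at infinity (all points $(a)$); $l_a=\{(a,y):y\in\mathbb{F}_q\}\cup\{(\infty)\}$ for $a\in\mathbb{F}_q$; $l_{a,b}=\{(x,y):y=x\circ a+b\}\cup\{(a)\}$ for $a,b\in\mathbb{F}_q$. A hyperoval is a set of $q+2$ points no three of which are collinear. *)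

theory Defs
  imports Complex_Main "HOL-Library.Cardinality"
begin

text \<open>The field with \<open>q = 2 ^ n\<close> elements is a finite field type \<open>'a\<close> with \<open>CARD('a) = 2 ^ n\<close>.
  The values of the absolute trace lie in the prime field \<open>{0, 1}\<close>, here taken inside \<open>'a\<close>.\<close>

definition abs_trace :: "nat \<Rightarrow> 'a::field \<Rightarrow> 'a" where
  "abs_trace n x = (\<Sum>i<n. x ^ (2 ^ i))"

definition td_mult :: "nat \<Rightarrow> 'a::field \<Rightarrow> 'a \<Rightarrow> 'a" where
  "td_mult n x y = x * y + abs_trace n x * y ^ (2 ^ (n - 1)) + abs_trace n (x\<^sup>2 * y)"

text \<open>\<open>At_Infinity (Some a)\<close> is the point \<open>(a)\<close> with \<open>a\<close> in the field, and
  \<open>At_Infinity None\<close> is the point \<open>(\<infinity>)\<close>.\<close>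

datatype 'a point = Affine 'a 'a | At_Infinity "'a option"

definition line_at_infinity :: "'a point set" where
  "line_at_infinity = range At_Infinity"

definition vertical_line :: "'a \<Rightarrow> 'a point set" where
  "vertical_line a = {Affine a y | y. True} \<union> {At_Infinity None}"

definition sloped_line :: "('a::plus \<Rightarrow> 'a \<Rightarrow> 'a) \<Rightarrow> 'a \<Rightarrow> 'a \<Rightarrow> 'a point set" where
  "sloped_line mult a b = {Affine x y | x y. y = mult x a + b} \<union> {At_Infinity (Some a)}"

definition plane_lines :: "('a::plus \<Rightarrow> 'a \<Rightarrow> 'a) \<Rightarrow> 'a point set set" where
  "plane_lines mult =
     {line_at_infinity} \<union> range vertical_line \<union> {sloped_line mult a b | a b. True}"

definition collinear3 :: "'p set set \<Rightarrow> 'p \<Rightarrow> 'p \<Rightarrow> 'p \<Rightarrow> bool" where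
  "collinear3 lines P Q R \<longleftrightarrow> (\<exists>l\<in>lines. P \<in> l \<and> Q \<in> l \<and> R \<in> l)"

definition hyperoval :: "nat \<Rightarrow> 'p set set \<Rightarrow> 'p set \<Rightarrow> bool" where
  "hyperoval q lines S \<longleftrightarrow>
     finite S \<and> card S = q + 2 \<and>
     (\<forall>P\<in>S. \<forall>Q\<in>S. \<forall>R\<in>S. P \<noteq> Q \<and> P \<noteq> R \<and> Q \<noteq> R \<longrightarrow> \<not> collinear3 lines P Q R)"

definition O_set :: "nat \<Rightarrow> 'a::field point set" where
  "O_set d = {Affine (y ^ (2 ^ d) + y) y | y. True} \<union> {At_Infinity (Some 0), At_Infinity (Some 1)}"

end

theory Submission
  imports Defs "HOL-Number_Theory.Residues"
begin

text \<open>
  Write \<open>L y = y ^ (2 ^ d) + y\<close>. Since \<open>gcd d n = 1\<close>, the additive map \<open>L\<close> has kernel \<open>{0, 1}\<close>,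
  and its values have trace 0, so that on the affine points of the hyperoval the presemifield
  product reduces to \<open>x \<circ> a = x a + Tr (x\<^sup>2 a)\<close>. Hence the difference \<open>u\<close> of two values of \<open>y\<close> on a
  common line of slope \<open>a\<close> satisfies \<open>u = a L u + Tr ((L u)\<^sup>2 a)\<close>. As the trace lies in the kernel
  of \<open>L\<close>, the element \<open>z = u + Tr ((L u)\<^sup>2 a)\<close> satisfies \<open>z = a L z\<close>, which has at most one nonzero
  solution, and \<open>u = z + Tr (z L z)\<close> is determined by \<open>z\<close>. So there is only one nonzero \<open>u\<close>, and a
  line of slope \<open>a\<close> carries at most two affine points; for \<open>a = 0, 1\<close> there is at most one.
\<close>

section \<open>Finite fields of even order\<close>

text \<open>Multiplication by a nonzero \<open>x\<close> permutes the nonzero elements, so comparing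
  their product before and after gives \<open>x ^ (CARD('a) - 1) = 1\<close>.\<close>

lemma field_power_card:
  fixes x :: "'a::{field,finite}"
  shows "x ^ CARD('a) = x"
proof (cases "x = 0")
  case False
  have "bij_betw ((*) x) (- {0}) (- {0})"
    by (rule bij_betwI[where g = "\<lambda>y. y / x"]) (use False in auto)
  then have "\<Prod>(- {0}) = (\<Prod>y\<in>- {0}. x * y)"
    by (rule prod.reindex_bij_betw[symmetric])
  also have "\<dots> = x ^ (CARD('a) - 1) * \<Prod>(- {0})"
    by (simp add: prod.distrib Compl_eq_Diff_UNIV)
  finally have "x ^ (CARD('a) - 1) = 1"
    by simp
  then show ?thesis
    by (metis finite_UNIV_card_ge_0 finite_class.finite_UNIV mult_1_right power_eq_if neq0_conv)
qed (simp add: finite_UNIV_card_ge_0)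

lemma CHAR_eq_2_if_card:
  assumes "CARD('a::{field,finite}) = 2 ^ n"
  shows "CHAR('a) = 2"
proof -
  have "prime CHAR('a)"
    by (intro prime_CHAR_semidom finite_imp_CHAR_pos) simp
  moreover have "CHAR('a) dvd 2 ^ n"
    using CHAR_dvd_CARD[where 'a = 'a] assms by simp
  ultimately show ?thesis
    using prime_dvd_power primes_dvd_imp_eq two_is_prime_nat by blast
qed

lemma add_eq_0_iff_CHAR_2:
  fixes x y :: "'a::ring_1"
  assumes "CHAR('a) = 2"
  shows "x + y = 0 \<longleftrightarrow> x = y"
  by (simp flip: minus_CHAR_2[OF assms])

lemma two_eq_0_CHAR_2:
  assumes "CHAR('a::semiring_1) = 2"
  shows "(2 :: 'a) = 0"
  using of_nat_CHAR[where 'a = 'a] assms by simp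

lemma frobenius_add:
  fixes x y :: "'a::comm_semiring_1"
  assumes "CHAR('a) = 2"
  shows "(x + y) ^ (2 ^ k) = x ^ (2 ^ k) + y ^ (2 ^ k)"
  by (rule freshmans_dream') (simp_all add: assms)

lemma power_power2_iterate:
  fixes t :: "'a::monoid_mult"
  assumes "t ^ (2 ^ d) = t"
  shows "t ^ (2 ^ (d * k)) = t"
  using assms by (induction k) (simp_all add: power_add power_mult)

text \<open>By Bezout some \<open>d * x\<close> exceeds a multiple of \<open>n\<close> by 1. An
  element fixed by both the \<open>d\<close>-th and the \<open>n\<close>-th iterate of squaring is
  therefore fixed by squaring itself.\<close>

lemma frobenius_fixed:
  fixes t :: "'a::{field,finite}"
  assumes "CARD('a) = 2 ^ n" "d > 0" "gcd d n = 1" "t ^ (2 ^ d) = t"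
  shows "t = 0 \<or> t = 1"
proof -
  obtain x y where xy: "d * x = n * y + 1"
    using bezout_nat[of d n] assms by auto
  have "t ^ (2 ^ n) = t"
    using field_power_card[of t] assms(1) by simp
  then have "t ^ (2 ^ (n * y)) = t"
    by (rule power_power2_iterate)
  then have "t ^ (2 ^ (d * x)) = t\<^sup>2"
    by (simp only: xy power_add power_mult power_one_right)
  with power_power2_iterate[OF assms(4), of x] have "t * (t - 1) = 0"
    by (simp add: power2_eq_square algebra_simps)
  then show ?thesis
    by simp
qed

section \<open>The absolute trace\<close>

lemma abs_trace_0 [simp]: "abs_trace n 0 = 0"
  by (simp add: abs_trace_def power_0_left)

lemma abs_trace_add:
  fixes x y :: "'a::field"
  assumes "CHAR('a) = 2"
  shows "abs_trace n (x + y) = abs_trace n x + abs_trace n y"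
  by (simp add: abs_trace_def frobenius_add[OF assms] sum.distrib)

text \<open>Squaring shifts the summands by one place: \<open>x\<close> drops out and
  \<open>x ^ (2 ^ n)\<close>, which equals \<open>x\<close>, comes in.\<close>

lemma abs_trace_square:
  fixes x :: "'a::{field,finite}"
  assumes "CARD('a) = 2 ^ n"
  shows "abs_trace n (x\<^sup>2) = abs_trace n x"
proof -
  have "abs_trace n (x\<^sup>2) = (\<Sum>i<n. x ^ (2 ^ Suc i))"
    by (simp add: abs_trace_def power_mult)
  moreover have "(\<Sum>i<n. x ^ (2 ^ Suc i)) + x = abs_trace n x + x ^ (2 ^ n)"
    using sum.lessThan_Suc_shift[of "\<lambda>i. x ^ (2 ^ i)" n]
    by (simp add: abs_trace_def add.commute)
  ultimately show ?thesis
    using field_power_card[of x] assms by simp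
qed

lemma abs_trace_frobenius:
  fixes x :: "'a::{field,finite}"
  assumes "CARD('a) = 2 ^ n"
  shows "abs_trace n (x ^ (2 ^ k)) = abs_trace n x"
proof (induction k)
  case (Suc k)
  have "x ^ (2 ^ Suc k) = (x ^ (2 ^ k))\<^sup>2"
    by (simp add: mult.commute flip: power_mult)
  then show ?case
    using Suc abs_trace_square[OF assms] by simp
qed simp

text \<open>This expresses that trace values lie in the prime field, in the form that puts them into
  the kernel of \<open>lin_binom d\<close>.\<close>

lemma abs_trace_power:
  fixes x :: "'a::{field,finite}"
  assumes "CARD('a) = 2 ^ n"
  shows "abs_trace n x ^ (2 ^ k) = abs_trace n x"
proof -
  have char: "CHAR('a) = 2"
    using assms by (rule CHAR_eq_2_if_card)
  have "abs_trace n x ^ (2 ^ k) = (\<Sum>i<n. (x ^ (2 ^ i)) ^ (2 ^ k))"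
    unfolding abs_trace_def by (rule freshmans_dream_sum') (simp_all add: char)
  also have "\<dots> = abs_trace n (x ^ (2 ^ k))"
    by (simp add: abs_trace_def mult.commute flip: power_mult)
  finally show ?thesis
    using abs_trace_frobenius[OF assms] by simp
qed

section \<open>The linearized binomial\<close>

definition lin_binom :: "nat \<Rightarrow> 'a::field \<Rightarrow> 'a" where
  "lin_binom d y = y ^ (2 ^ d) + y"

lemma lin_binom_add:
  fixes x y :: "'a::field"
  assumes "CHAR('a) = 2"
  shows "lin_binom d (x + y) = lin_binom d x + lin_binom d y"
  by (simp add: lin_binom_def frobenius_add[OF assms])

lemma abs_trace_lin_binom:
  fixes y :: "'a::{field,finite}"
  assumes "CARD('a) = 2 ^ n"
  shows "abs_trace n (lin_binom d y) = 0"
proof -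
  have char: "CHAR('a) = 2"
    using assms by (rule CHAR_eq_2_if_card)
  show ?thesis
    by (simp add: lin_binom_def abs_trace_add[OF char] abs_trace_frobenius[OF assms]
        two_eq_0_CHAR_2[OF char])
qed

lemma lin_binom_trace:
  fixes x :: "'a::{field,finite}"
  assumes "CARD('a) = 2 ^ n"
  shows "lin_binom d (abs_trace n x) = 0"
  by (simp add: lin_binom_def abs_trace_power[OF assms]
      two_eq_0_CHAR_2[OF CHAR_eq_2_if_card[OF assms]])

lemma lin_binom_kernel:
  fixes y :: "'a::{field,finite}"
  assumes "CARD('a) = 2 ^ n" "d > 0" "gcd d n = 1" "lin_binom d y = 0"
  shows "y = 0 \<or> y = 1"
  using assms frobenius_fixed[OF assms(1-3), of y]
  by (simp add: lin_binom_def add_eq_0_iff_CHAR_2[OF CHAR_eq_2_if_card[OF assms(1)]])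

text \<open>Eliminating \<open>a\<close> from the two equations shows that \<open>w / z\<close> is
  fixed by the power \<open>2 ^ d\<close>, so this nonzero quotient is 1.\<close>

lemma lin_binom_eigenvector_unique:
  fixes z w :: "'a::{field,finite}"
  assumes "CARD('a) = 2 ^ n" "d > 0" "gcd d n = 1"
    and "z = a * lin_binom d z" "w = a * lin_binom d w" "z \<noteq> 0" "w \<noteq> 0"
  shows "z = w"
proof -
  have "a \<noteq> 0"
    using assms by auto
  have "a * (w * lin_binom d z) = a * (z * lin_binom d w)"
    using assms(4,5) by (metis mult.assoc mult.commute)
  with \<open>a \<noteq> 0\<close> have "w * z ^ (2 ^ d) = z * w ^ (2 ^ d)"
    by (simp add: lin_binom_def algebra_simps)
  then have "(w / z) ^ (2 ^ d) = w / z"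
    using assms(6,7) by (simp add: power_divide field_simps)
  then show ?thesis
    using frobenius_fixed[OF assms(1-3), of "w / z"] assms(6,7) by simp
qed

lemma slope_equation_unique:
  fixes u v a :: "'a::{field,finite}"
  assumes "CARD('a) = 2 ^ n" "d > 0" "gcd d n = 1"
    and "u = lin_binom d u * a + abs_trace n ((lin_binom d u)\<^sup>2 * a)" "u \<noteq> 0"
    and "v = lin_binom d v * a + abs_trace n ((lin_binom d v)\<^sup>2 * a)" "v \<noteq> 0"
  shows "u = v"
proof -
  have char: "CHAR('a) = 2"
    using assms(1) by (rule CHAR_eq_2_if_card)
  have red: "\<exists>z. z \<noteq> 0 \<and> z = a * lin_binom d z \<and> u = z + abs_trace n (z * lin_binom d z)"
    if eq: "u = lin_binom d u * a + abs_trace n ((lin_binom d u)\<^sup>2 * a)" and "u \<noteq> 0" for u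
  proof -
    define z where "z = lin_binom d u * a"
    define t where "t = abs_trace n ((lin_binom d u)\<^sup>2 * a)"
    have u: "u = z + t"
      using eq by (simp add: z_def t_def)
    \<comment> \<open>The elements \<open>u\<close> and \<open>z\<close> differ by a trace, which
      \<open>lin_binom d\<close> annihilates.\<close>
    have L: "lin_binom d u = lin_binom d z"
      by (subst u) (simp add: lin_binom_add[OF char] t_def lin_binom_trace[OF assms(1)])
    then have z: "z = a * lin_binom d z"
      by (simp add: z_def)
    have "(lin_binom d u)\<^sup>2 * a = z * lin_binom d z"
      using L by (simp add: z_def power2_eq_square)
    then have t: "t = abs_trace n (z * lin_binom d z)"
      by (simp add: t_def)
    \<comment> \<open>If \<open>z\<close> were 0, then \<open>t\<close> would be the trace of 0, and
      \<open>u = z + t\<close> would vanish.\<close>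
    then have "z \<noteq> 0"
      using u \<open>u \<noteq> 0\<close> by (cases "z = 0") simp_all
    then show ?thesis
      using u z unfolding t by blast
  qed
  obtain z where z: "z \<noteq> 0" "z = a * lin_binom d z" "u = z + abs_trace n (z * lin_binom d z)"
    using red[OF assms(4,5)] by blast
  obtain w where w: "w \<noteq> 0" "w = a * lin_binom d w" "v = w + abs_trace n (w * lin_binom d w)"
    using red[OF assms(6,7)] by blast
  have "z = w"
    using lin_binom_eigenvector_unique[OF assms(1-3)] z(1,2) w(1,2) by blast
  then show ?thesis
    using z(3) w(3) by simp
qed

section \<open>Lines meeting the hyperoval\<close>

abbreviation curve_point :: "nat \<Rightarrow> 'a::field \<Rightarrow> 'a point" where
  "curve_point d y \<equiv> Affine (lin_binom d y) y"

lemma O_set_eq: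
  "O_set d = range (curve_point d) \<union> {At_Infinity (Some 0), At_Infinity (Some 1)}"
  by (auto simp: O_set_def lin_binom_def)

text \<open>The second coordinate separates the affine points, although \<open>lin_binom d\<close>
  need not be injective.\<close>

lemma card_O_set: "card (O_set d :: 'a::{field,finite} point set) = CARD('a) + 2"
proof -
  have "card (range (curve_point d :: 'a \<Rightarrow> _)) = CARD('a)"
    by (rule card_image) (simp add: inj_on_def)
  moreover have "range (curve_point d :: 'a \<Rightarrow> _) \<inter>
      {At_Infinity (Some 0), At_Infinity (Some 1)} = {}"
    by auto
  ultimately show ?thesis
    by (simp add: O_set_eq card_Un_disjoint)
qed

text \<open>The middle term of \<open>td_mult\<close> carries the factor
  \<open>abs_trace n (lin_binom d y)\<close>, which is 0.\<close>

lemma curve_point_in_sloped_line: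
  fixes y :: "'a::{field,finite}"
  assumes "CARD('a) = 2 ^ n"
  shows "curve_point d y \<in> sloped_line (td_mult n) a b \<longleftrightarrow>
    y = lin_binom d y * a + abs_trace n ((lin_binom d y)\<^sup>2 * a) + b"
  by (simp add: sloped_line_def td_mult_def abs_trace_lin_binom[OF assms])

text \<open>In characteristic 2 the difference of \<open>x\<close> and \<open>y\<close> is their
  sum, and adding the two line equations cancels the intercept \<open>b\<close>.\<close>

lemma curve_points_in_sloped_line_diff:
  fixes x y :: "'a::{field,finite}"
  assumes "CARD('a) = 2 ^ n"
    and "curve_point d x \<in> sloped_line (td_mult n) a b"
    and "curve_point d y \<in> sloped_line (td_mult n) a b"
  defines "u \<equiv> x + y"
  shows "u = lin_binom d u * a + abs_trace n ((lin_binom d u)\<^sup>2 * a)"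
proof -
  have char: "CHAR('a) = 2"
    using assms(1) by (rule CHAR_eq_2_if_card)
  have "b + b = 0"
    by (simp add: two_eq_0_CHAR_2[OF char])
  moreover have "x = lin_binom d x * a + abs_trace n ((lin_binom d x)\<^sup>2 * a) + b"
    and "y = lin_binom d y * a + abs_trace n ((lin_binom d y)\<^sup>2 * a) + b"
    using assms(2,3) curve_point_in_sloped_line[OF assms(1)] by blast+
  from arg_cong2[OF this, of "(+)"]
  have "x + y = lin_binom d x * a + lin_binom d y * a
      + (abs_trace n ((lin_binom d x)\<^sup>2 * a) + abs_trace n ((lin_binom d y)\<^sup>2 * a)) + (b + b)"
    by (simp only: ac_simps)
  moreover have "(lin_binom d x + lin_binom d y)\<^sup>2 = (lin_binom d x)\<^sup>2 + (lin_binom d y)\<^sup>2"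
    using frobenius_add[OF char, of _ _ 1] by simp
  ultimately show ?thesis
    unfolding u_def lin_binom_add[OF char] by (simp only: abs_trace_add[OF char] distrib_right add_0_right)
qed

text \<open>These slopes allow only one affine point, since the line already passes through
  \<open>(0)\<close> or \<open>(1)\<close>. For slope 1 the trace term is the trace of
  \<open>lin_binom d (x + y)\<close>, hence 0, and what remains is
  \<open>u = u ^ (2 ^ d) + u\<close> for \<open>u = x + y\<close>.\<close>

lemma curve_point_unique_on_sloped_line_01:
  fixes x y :: "'a::{field,finite}"
  assumes "CARD('a) = 2 ^ n" "a = 0 \<or> a = 1"
    and "curve_point d x \<in> sloped_line (td_mult n) a b"
    and "curve_point d y \<in> sloped_line (td_mult n) a b"
  shows "x = y"
proof -
  have char: "CHAR('a) = 2"
    using assms(1) by (rule CHAR_eq_2_if_card)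
  have eq: "x + y = lin_binom d (x + y) * a + abs_trace n ((lin_binom d (x + y))\<^sup>2 * a)"
    using curve_points_in_sloped_line_diff[OF assms(1,3,4)] .
  have "x + y = 0"
    using assms(2)
  proof
    assume "a = 1"
    then have "(x + y) ^ (2 ^ d) = 0"
      using eq by (simp add: abs_trace_square[OF assms(1)] abs_trace_lin_binom[OF assms(1)])
        (simp add: lin_binom_def)
    then show ?thesis
      by simp
  qed (use eq in simp)
  then show ?thesis
    by (simp add: add_eq_0_iff_CHAR_2[OF char])
qed

text \<open>Covering the intersection by two possibly equal points excludes three distinct collinear
  points without counting.\<close>

lemma plane_line_meets_O_set:
  fixes l :: "'a::{field,finite} point set"
  assumes "CARD('a) = 2 ^ n" "d > 0" "gcd d n = 1"
    and "l \<in> plane_lines (td_mult n)"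
  shows "\<exists>P Q. O_set d \<inter> l \<subseteq> {P, Q}"
proof -
  have char: "CHAR('a) = 2"
    using assms(1) by (rule CHAR_eq_2_if_card)
  consider "l = line_at_infinity" | a where "l = vertical_line a"
    | a b where "l = sloped_line (td_mult n) a b"
    using assms(4) by (auto simp: plane_lines_def)
  then show ?thesis
  proof cases
    case 1
    then have "O_set d \<inter> l \<subseteq> {At_Infinity (Some 0), At_Infinity (Some 1)}"
      by (auto simp: O_set_eq line_at_infinity_def)
    then show ?thesis
      by blast
  next
    case (2 a)
    show ?thesis
    proof (cases "\<exists>y. lin_binom d y = a")
      case True
      then obtain y0 where y0: "lin_binom d y0 = a"
        by blast
      \<comment> \<open>A nonempty fibre of \<open>lin_binom d\<close> is a coset of its
        kernel.\<close>
      have "y = y0 \<or> y = y0 + 1" if "lin_binom d y = a" for y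
      proof -
        have "lin_binom d (y0 + y) = 0"
          by (simp add: lin_binom_add[OF char] y0 that two_eq_0_CHAR_2[OF char])
        then have "y0 + y = 0 \<or> y0 + y = 1"
          by (rule lin_binom_kernel[OF assms(1-3)])
        then have "y0 = y \<or> y = 1 - y0"
          by (simp add: add_eq_0_iff_CHAR_2[OF char] eq_diff_eq add.commute)
        then show ?thesis
          by (auto simp: minus_CHAR_2[OF char] add.commute)
      qed
      then have "O_set d \<inter> l \<subseteq> {curve_point d y0, curve_point d (y0 + 1)}"
        using 2 by (auto simp: O_set_eq vertical_line_def)
      then show ?thesis
        by blast
    next
      case False
      then have "O_set d \<inter> l = {}"
        using 2 by (auto simp: O_set_eq vertical_line_def)
      then show ?thesis
        by blast
    qed
  next
    case (3 a b)
    define Y where "Y = {y. curve_point d y \<in> l}"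
    have inter: "O_set d \<inter> l \<subseteq>
        curve_point d ` Y \<union> (if a = 0 \<or> a = 1 then {At_Infinity (Some a)} else {})"
      using 3 by (auto simp: O_set_eq Y_def sloped_line_def)
    show ?thesis
    proof (cases "a = 0 \<or> a = 1")
      case True
      then have "x = y" if "x \<in> Y" "y \<in> Y" for x y
        using curve_point_unique_on_sloped_line_01[OF assms(1), of a d x b y] that 3
        by (simp add: Y_def)
      then obtain y where "Y \<subseteq> {y}"
        by blast
      then have "O_set d \<inter> l \<subseteq> {curve_point d y, At_Infinity (Some a)}"
        using inter True by auto
      then show ?thesis
        by blast
    next
      case False
      \<comment> \<open>With \<open>w\<close> as base point, \<open>w + x\<close> and
        \<open>w + y\<close> are nonzero solutions of the same slope equation, so they agree. Hence
        \<open>Y\<close> has at most one element besides \<open>w\<close>.\<close>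
      have "x = y" if "w \<in> Y" "x \<in> Y" "y \<in> Y" "x \<noteq> w" "y \<noteq> w" for w x y
      proof -
        have "w + x \<noteq> 0" "w + y \<noteq> 0"
          using that(4,5) by (auto simp: add_eq_0_iff_CHAR_2[OF char])
        moreover note curve_points_in_sloped_line_diff[OF assms(1), of d w a b x]
          curve_points_in_sloped_line_diff[OF assms(1), of d w a b y]
        ultimately have "w + x = w + y"
          using that(1-3) 3 slope_equation_unique[OF assms(1-3), of "w + x" a "w + y"]
          by (simp add: Y_def)
        then show ?thesis
          by simp
      qed
      then obtain x y where "Y \<subseteq> {x, y}"
        by blast
      then have "O_set d \<inter> l \<subseteq> {curve_point d x, curve_point d y}"
        using inter False by auto
      then show ?thesis
        by blast
    qed
  qed
qed

theorem theorem4p1: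
  fixes n d q :: nat
  assumes "n > 0" and "odd n"
    and "d > 0" and "gcd d n = 1"
    and "q = 2 ^ n"
    and "CARD('a::{field,finite}) = q"
  shows "hyperoval q (plane_lines (td_mult n)) (O_set d :: 'a point set)"
proof -
  have card: "CARD('a) = 2 ^ n"
    using assms by simp
  have "\<not> collinear3 (plane_lines (td_mult n)) P Q R"
    if "P \<in> O_set d" "Q \<in> O_set d" "R \<in> O_set d" "P \<noteq> Q" "P \<noteq> R" "Q \<noteq> R"
    for P Q R :: "'a point"
  proof
    assume "collinear3 (plane_lines (td_mult n)) P Q R"
    then obtain l where l: "l \<in> plane_lines (td_mult n)" "P \<in> l" "Q \<in> l" "R \<in> l"
      by (auto simp: collinear3_def)
    obtain S T where "O_set d \<inter> l \<subseteq> {S, T}"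
      using plane_line_meets_O_set[OF card assms(3,4) l(1)] by blast
    then show False
      using that l by blast
  qed
  moreover have "finite (O_set d :: 'a point set)"
    by (simp add: O_set_eq)
  ultimately show ?thesis
    using card_O_set[of d, where 'a = 'a] assms(6) by (simp add: hyperoval_def)
qed

end
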